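(* Let $a\geq 0$ and $b\geq 1$ be integers. The complete split graph $K_a\vee \overline{K}_b$ is isomorphic to $\Gamma_P(R)$ for some finite commutative ring $R$ with identity and some proper prime ideal $P$ of $R$ if and only if there exists a prime power $q$ such that $b=(a+1)(q-1)$. In that case, one may realize the graph by taking $R=\mathbb{F}_q\times \mathbb{Z}/(a+1)\mathbb{Z}$ and $P=\{0\}\times \mathbb{Z}/(a+1)\mathbb{Z}$.
   Context: For a finite commutative ring $R$ with identity and a proper prime ideal $P$, the prime ideal graph $\Gamma_P(R)$ is the simple graph with vertex set $R\setminus\{0\}$ in which two distinct vertices $x,y$ are adjacent if and only if $xy\in P$. $K_a$ is the complete graph on $a$ vertices, $\overline{K}_b$ is the edgeless graph on $b$ vertices ($K_0$ is the graph with no vertices). For vertex-disjoint graphs $G,H$, the join $G\vee H$ is obtained from the disjoint union of $G$ and $H$ by adding all edges between every vertex of $G$ and every vertex of $H$. $\mathbb{F}_q$ is the finite field with $q$ elements; $\mathbb{Z}/1\mathbb{Z}$ is the zero ring. *)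

theory Defs
  imports
    "HOL-Algebra.IntRing"
    "HOL-Algebra.Chinese_Remainder"
    "HOL-Number_Theory.Prime_Powers"
    "Graph_Theory.Pair_Digraph"
    "Graph_Theory.Digraph_Isomorphism"
begin

text \<open>
  A finite simple graph is a \<open>pair_graph\<close>: a finite vertex set with an irreflexive,
  symmetric set of arcs, an edge between \<open>x\<close> and \<open>y\<close> being the pair of arcs \<open>(x, y)\<close> and \<open>(y, x)\<close>.
\<close>

definition prime_ideal_graph :: "('r, 'm) ring_scheme \<Rightarrow> 'r set \<Rightarrow> 'r pair_pre_digraph" where
  "prime_ideal_graph R P =
    \<lparr> pverts = carrier R - {\<zero>\<^bsub>R\<^esub>},
      parcs = {(x, y). x \<in> carrier R - {\<zero>\<^bsub>R\<^esub>} \<and> y \<in> carrier R - {\<zero>\<^bsub>R\<^esub>} \<and> x \<noteq> y \<and> x \<otimes>\<^bsub>R\<^esub> y \<in> P} \<rparr>"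

definition complete_graph :: "nat \<Rightarrow> nat pair_pre_digraph" where
  "complete_graph n = \<lparr> pverts = {..<n}, parcs = {(i, j). i < n \<and> j < n \<and> i \<noteq> j} \<rparr>"

definition edgeless_graph :: "nat \<Rightarrow> nat pair_pre_digraph" where
  "edgeless_graph n = \<lparr> pverts = {..<n}, parcs = {} \<rparr>"

text \<open>The sum type makes the vertex sets of the two joined graphs disjoint.\<close>

definition graph_join :: "'a pair_pre_digraph \<Rightarrow> 'b pair_pre_digraph \<Rightarrow> ('a + 'b) pair_pre_digraph" where
  "graph_join G H =
    \<lparr> pverts = Inl ` pverts G \<union> Inr ` pverts H,
      parcs = map_prod Inl Inl ` parcs G \<union> map_prod Inr Inr ` parcs H
        \<union> (Inl ` pverts G \<times> Inr ` pverts H) \<union> (Inr ` pverts H \<times> Inl ` pverts G) \<rparr>"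

text \<open>
  \<open>primeideal P R\<close> includes properness of \<open>P\<close>.  Every finite ring is isomorphic to one whose
  carrier is a set of natural numbers, so the existence of a finite ring realizing a graph can be
  stated with a witness of type \<open>nat ring\<close>.
\<close>

definition realizes :: "('r, 'm) ring_scheme \<Rightarrow> 'r set \<Rightarrow> 'v pair_pre_digraph \<Rightarrow> bool" where
  "realizes R P G \<longleftrightarrow> cring R \<and> finite (carrier R) \<and> primeideal P R \<and>
    digraph_iso (with_proj G) (with_proj (prime_ideal_graph R P))"

lemma pair_graph_prime_ideal_graph:
  assumes "cring R" "finite (carrier R)"
  shows "pair_graph (prime_ideal_graph R P)"
proof -
  interpret cring R by fact
  have "finite (parcs (prime_ideal_graph R P))"
    by (rule finite_subset[of _ "carrier R \<times> carrier R"])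
      (auto simp: prime_ideal_graph_def assms)
  then show ?thesis
    by unfold_locales
      (auto simp: prime_ideal_graph_def symmetric_def sym_def m_comm assms)
qed

lemma pair_graph_complete_graph: "pair_graph (complete_graph n)"
proof -
  have "finite (parcs (complete_graph n))"
    by (rule finite_subset[of _ "{..<n} \<times> {..<n}"]) (auto simp: complete_graph_def)
  then show ?thesis
    by unfold_locales (auto simp: complete_graph_def symmetric_def sym_def)
qed

lemma pair_graph_edgeless_graph: "pair_graph (edgeless_graph n)"
  by unfold_locales (auto simp: edgeless_graph_def symmetric_def sym_def)

lemma pair_graph_graph_join:
  assumes "pair_graph G" "pair_graph H"
  shows "pair_graph (graph_join G H)"
proof -
  interpret G: pair_graph G by fact
  interpret H: pair_graph H by fact
  have vG: "x \<in> pverts G \<and> y \<in> pverts G" if "(x, y) \<in> parcs G" for x y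
    using G.arc_fst_in_verts[OF that] G.arc_snd_in_verts[OF that] by simp
  have vH: "x \<in> pverts H \<and> y \<in> pverts H" if "(x, y) \<in> parcs H" for x y
    using H.arc_fst_in_verts[OF that] H.arc_snd_in_verts[OF that] by simp
  have "finite (parcs (graph_join G H))" "finite (pverts (graph_join G H))"
    by (simp_all add: graph_join_def)
  moreover have "sym (parcs (graph_join G H))"
    by (rule symI) (auto simp: graph_join_def G.arcs_symmetric H.arcs_symmetric)
  moreover have "e \<in> parcs (graph_join G H) \<Longrightarrow> fst e \<noteq> snd e" for e
    using G.pair_no_loops H.pair_no_loops by (auto simp: graph_join_def)
  moreover have "e \<in> parcs (graph_join G H) \<Longrightarrow>
      fst e \<in> pverts (graph_join G H) \<and> snd e \<in> pverts (graph_join G H)" for e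
    using vG vH by (auto simp: graph_join_def)
  ultimately show ?thesis
    by unfold_locales (simp_all add: symmetric_def)
qed

text \<open>For arcs given as pairs, \<open>digraph_iso\<close> is a bijection of vertices preserving and reflecting adjacency.\<close>

lemma digraph_iso_with_proj_iff:
  assumes "pair_graph G" "pair_graph H"
  shows "digraph_iso (with_proj G) (with_proj H) \<longleftrightarrow>
    (\<exists>f. bij_betw f (pverts G) (pverts H) \<and>
      (\<forall>x\<in>pverts G. \<forall>y\<in>pverts G. (f x, f y) \<in> parcs H \<longleftrightarrow> (x, y) \<in> parcs G))"
proof
  interpret G: pair_graph G by fact
  interpret H: pair_graph H by fact
  {
    assume "digraph_iso (with_proj G) (with_proj H)"
    then obtain h where h: "pre_digraph.digraph_isomorphism (with_proj G) h"
      and H: "with_proj H = app_iso h (with_proj G)"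
      by (auto simp: digraph_iso_def)
    let ?f = "iso_verts h"
    have pv: "pverts H = ?f ` pverts G" using arg_cong[OF H, of verts] by simp
    have pa: "parcs H = iso_arcs h ` parcs G" using arg_cong[OF H, of arcs] by simp
    have th: "iso_tail h = fst" "iso_head h = snd"
      using arg_cong[OF H, of tail] arg_cong[OF H, of head] by simp_all
    have inj: "inj_on ?f (pverts G)"
      using h by (simp add: pre_digraph.digraph_isomorphism_def)
    have arc: "iso_arcs h e = (?f (fst e), ?f (snd e))" if "e \<in> parcs G" for e
      using h that th by (simp add: pre_digraph.digraph_isomorphism_def prod_eq_iff)
    have "(?f x, ?f y) \<in> parcs H \<longleftrightarrow> (x, y) \<in> parcs G" if "x \<in> pverts G" "y \<in> pverts G" for x y
    proof
      assume "(?f x, ?f y) \<in> parcs H"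
      then obtain e where e: "e \<in> parcs G" "?f x = ?f (fst e)" "?f y = ?f (snd e)"
        using pa arc by auto
      then have "x = fst e" "y = snd e"
        using inj that G.arc_fst_in_verts G.arc_snd_in_verts by (auto dest: inj_onD)
      then show "(x, y) \<in> parcs G" using e by simp
    next
      assume "(x, y) \<in> parcs G"
      then show "(?f x, ?f y) \<in> parcs H" using arc pa by force
    qed
    then show "\<exists>f. bij_betw f (pverts G) (pverts H) \<and>
      (\<forall>x\<in>pverts G. \<forall>y\<in>pverts G. (f x, f y) \<in> parcs H \<longleftrightarrow> (x, y) \<in> parcs G)"
      using inj pv by (auto simp: bij_betw_def)
  next
    assume "\<exists>f. bij_betw f (pverts G) (pverts H) \<and>
      (\<forall>x\<in>pverts G. \<forall>y\<in>pverts G. (f x, f y) \<in> parcs H \<longleftrightarrow> (x, y) \<in> parcs G)"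
    then obtain f where f: "inj_on f (pverts G)" "f ` pverts G = pverts H"
      and adj: "\<And>x y. x \<in> pverts G \<Longrightarrow> y \<in> pverts G \<Longrightarrow> (f x, f y) \<in> parcs H \<longleftrightarrow> (x, y) \<in> parcs G"
      by (auto simp: bij_betw_def)
    define h where "h = \<lparr> iso_verts = f, iso_arcs = map_prod f f, iso_head = snd, iso_tail = fst \<rparr>"
    have "wf_digraph (with_proj G)" ..
    moreover have "inj_on (map_prod f f) (parcs G)"
      by (rule inj_on_subset[OF map_prod_inj_on[OF f(1) f(1)]])
        (auto dest: G.arc_fst_in_verts G.arc_snd_in_verts)
    ultimately have "pre_digraph.digraph_isomorphism (with_proj G) h"
      using f(1) by (simp add: pre_digraph.digraph_isomorphism_def h_def)
    moreover have "parcs H = map_prod f f ` parcs G"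
    proof
      show "parcs H \<subseteq> map_prod f f ` parcs G"
      proof
        fix e assume e: "e \<in> parcs H"
        then have "fst e \<in> f ` pverts G" "snd e \<in> f ` pverts G"
          using f(2) H.arc_fst_in_verts H.arc_snd_in_verts by auto
        then obtain x y where xy: "x \<in> pverts G" "y \<in> pverts G" "e = (f x, f y)"
          by (metis imageE prod.collapse)
        then have "(x, y) \<in> parcs G" using adj e by simp
        then show "e \<in> map_prod f f ` parcs G" using xy by force
      qed
      show "map_prod f f ` parcs G \<subseteq> parcs H"
        using adj G.arc_fst_in_verts G.arc_snd_in_verts by fastforce
    qed
    then have "with_proj H = app_iso h (with_proj G)"
      using f(2) by (simp add: with_proj_def app_iso_def h_def)
    ultimately show "digraph_iso (with_proj G) (with_proj H)"
      by (auto simp: digraph_iso_def)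
  }
qed

end

theory Submission
  imports
    "HOL-Algebra.Algebraic_Closure"
    "HOL-Algebra.Sylow"
    "HOL-Number_Theory.Residues"
    Defs
begin

text \<open>
  For a prime ideal \<open>P\<close>, the nonzero elements of \<open>P\<close> are adjacent to every other vertex of the prime
  ideal graph, while the elements outside \<open>P\<close> are pairwise non-adjacent.  Hence the graph is the
  complete split graph with parts of sizes \<open>|P| - 1\<close> and \<open>|R| - |P|\<close>, and it is isomorphic to
  \<open>K\<^sub>a\<close> joined with \<open>b \<ge> 1\<close> isolated vertices exactly if \<open>|P| = a + 1\<close> and \<open>|R| - |P| = b\<close>
  (\<open>realizes_complete_split_iff\<close>).

  Necessity: \<open>R / P\<close> is a finite domain.  Its order \<open>q\<close> is a prime power by a Sylow argument in its
  additive group (\<open>primepow_card_carrier\<close>), and Lagrange's theorem gives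
  \<open>b = |R| - |P| = (q - 1) |P| = (a + 1) (q - 1)\<close>.

  Sufficiency: for a field \<open>F\<close> with \<open>q\<close> elements, the ideal \<open>{0} \<times> \<int>/(a+1)\<int>\<close> of \<open>F \<times> \<int>/(a+1)\<int>\<close> is the
  preimage of the zero ideal under the projection to \<open>F\<close>, hence prime, and it has the right size.
  That a field with \<open>q\<close> elements exists (\<open>exists_finite_field\<close>) is shown inside the algebraic
  closure of \<open>\<int>/p\<int>\<close>: the solutions of \<open>x\<^sup>q = x\<close> form a subfield because taking \<open>q\<close>-th powers is additive
  in characteristic \<open>p\<close>, and there are exactly \<open>q\<close> of them because \<open>X\<^sup>q - X\<close> has no multiple root.
\<close>

section \<open>Powers of sums in characteristic \<open>p\<close>\<close>

lemma (in cring) binomial_expansion: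
  assumes x: "x \<in> carrier R" and y: "y \<in> carrier R"
  shows "(x \<oplus> y) [^] (n :: nat) = (\<Oplus>k\<in>{..n}. [(n choose k)] \<cdot> (x [^] k \<otimes> y [^] (n - k)))"
proof (induction n)
  case 0
  show ?case by simp
next
  case (Suc n)
  define s where "s k = x [^] k \<otimes> y [^] (n - k)" for k
  define t where "t k = x [^] k \<otimes> y [^] (Suc n - k)" for k
  have s [simp]: "s k \<in> carrier R" and t [simp]: "t k \<in> carrier R" for k
    using x y by (simp_all add: s_def t_def)
  have sx: "s k \<otimes> x = t (Suc k)" for k
    using x y by (simp add: s_def t_def m_assoc m_lcomm m_comm)
  have sy: "s k \<otimes> y = t k" if "k \<le> n" for k
    using x y that by (simp add: s_def t_def m_assoc Suc_diff_le)
  have "(x \<oplus> y) [^] Suc n = (\<Oplus>k\<in>{..n}. [(n choose k)] \<cdot> s k) \<otimes> (x \<oplus> y)"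
    using Suc by (simp add: s_def)
  also have "\<dots> = (\<Oplus>k\<in>{..n}. [(n choose k)] \<cdot> s k) \<otimes> x \<oplus> (\<Oplus>k\<in>{..n}. [(n choose k)] \<cdot> s k) \<otimes> y"
    using x y by (simp add: r_distr)
  also have "(\<Oplus>k\<in>{..n}. [(n choose k)] \<cdot> s k) \<otimes> x = (\<Oplus>k\<in>{..n}. [(n choose k)] \<cdot> t (Suc k))"
    using x by (simp add: finsum_ldistr add_pow_ldistr sx)
  also have "(\<Oplus>k\<in>{..n}. [(n choose k)] \<cdot> s k) \<otimes> y = (\<Oplus>k\<in>{..n}. [(n choose k)] \<cdot> t k)"
    using y by (auto simp add: finsum_ldistr add_pow_ldistr sy intro!: finsum_cong')
  also have "\<dots> = (\<Oplus>k\<in>{..Suc n}. [(n choose k)] \<cdot> t k)"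
    by (subst finsum_Suc) (simp_all add: binomial_eq_0)
  also have "\<dots> = (\<Oplus>k\<in>{..n}. [(n choose Suc k)] \<cdot> t (Suc k)) \<oplus> [(n choose 0)] \<cdot> t 0"
    by (subst finsum_Suc2) simp_all
  also have "(\<Oplus>k\<in>{..n}. [(n choose k)] \<cdot> t (Suc k)) \<oplus>
      ((\<Oplus>k\<in>{..n}. [(n choose Suc k)] \<cdot> t (Suc k)) \<oplus> [(n choose 0)] \<cdot> t 0)
    = (\<Oplus>k\<in>{..n}. [(n choose k)] \<cdot> t (Suc k) \<oplus> [(n choose Suc k)] \<cdot> t (Suc k)) \<oplus> [(n choose 0)] \<cdot> t 0"
    by (simp add: finsum_addf a_assoc)
  also have "\<dots> = (\<Oplus>k\<in>{..n}. [(Suc n choose Suc k)] \<cdot> t (Suc k)) \<oplus> [(Suc n choose 0)] \<cdot> t 0"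
    by (simp add: add.nat_pow_mult)
  also have "\<dots> = (\<Oplus>k\<in>{..Suc n}. [(Suc n choose k)] \<cdot> t k)"
    by (subst finsum_Suc2) simp_all
  finally show ?case by (simp add: t_def)
qed

lemma (in ring) add_pow_eq_zero_of_dvd:
  fixes p k :: nat
  assumes "[p] \<cdot> \<one> = \<zero>" and "p dvd k" and z: "z \<in> carrier R"
  shows "[k] \<cdot> z = \<zero>"
proof -
  have "[p] \<cdot> z = ([p] \<cdot> \<one>) \<otimes> z"
    using z by (simp add: add_pow_ldistr)
  then have "[p] \<cdot> z = \<zero>" using assms z by simp
  moreover obtain m where "k = p * m" using \<open>p dvd k\<close> ..
  ultimately show ?thesis
    using add.nat_pow_pow[OF z, of m p] by simp
qed

text \<open>
  For exponent \<open>p\<close>, every inner binomial coefficient is divisible by \<open>p\<close>, so only the two outer terms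
  of the binomial expansion survive; iterating the case of exponent \<open>p\<close> gives the powers of \<open>p\<close>.
  The statement is about commutative rings because it is used both in an algebraic closure and
  in the polynomial ring over it.
\<close>

lemma (in cring) freshmans_dream:
  fixes p n :: nat
  assumes p: "prime p" and char: "[p] \<cdot> \<one> = \<zero>"
    and x: "x \<in> carrier R" and y: "y \<in> carrier R"
  shows "(x \<oplus> y) [^] (p ^ n) = x [^] (p ^ n) \<oplus> y [^] (p ^ n)"
proof (induction n)
  case 0
  show ?case using x y by simp
next
  case (Suc n)
  have one: "(u \<oplus> v) [^] p = u [^] p \<oplus> v [^] p" if u: "u \<in> carrier R" and v: "v \<in> carrier R" for u v
  proof -
    obtain j where j: "p = Suc (Suc j)"
      using prime_ge_2_nat[OF p] by (metis add_2_eq_Suc le_Suc_ex)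
    define f where "f k = [(p choose k)] \<cdot> (u [^] k \<otimes> v [^] (p - k))" for k
    have f [simp]: "f k \<in> carrier R" for k using u v by (simp add: f_def)
    have mid: "f (Suc i) = \<zero>" if "i \<le> j" for i
      unfolding f_def using that u v j p dvd_choose_prime[of "Suc i" p]
      by (intro add_pow_eq_zero_of_dvd[OF char]) simp_all
    have "(u \<oplus> v) [^] p = (\<Oplus>k\<in>{..Suc (Suc j)}. f k)"
      unfolding binomial_expansion[OF u v] f_def j ..
    also have "\<dots> = f p \<oplus> ((\<Oplus>i\<in>{..j}. f (Suc i)) \<oplus> f 0)"
      by (subst finsum_Suc, simp, subst finsum_Suc2) (simp_all add: j)
    also have "(\<Oplus>i\<in>{..j}. f (Suc i)) = \<zero>"
      using mid by (intro add.finprod_one_eqI) simp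
    finally show ?thesis using u v by (simp add: f_def)
  qed
  have "(x \<oplus> y) [^] (p ^ Suc n) = ((x \<oplus> y) [^] (p ^ n)) [^] p"
    using x y by (simp add: nat_pow_pow mult.commute)
  also have "\<dots> = (x [^] (p ^ n)) [^] p \<oplus> (y [^] (p ^ n)) [^] p"
    using x y by (simp add: Suc one)
  also have "\<dots> = x [^] (p ^ Suc n) \<oplus> y [^] (p ^ Suc n)"
    using x y by (simp add: nat_pow_pow mult.commute)
  finally show ?case .
qed

section \<open>Existence of finite fields\<close>

text \<open>
  A split polynomial has as many roots, counted with multiplicity, as its degree says.  That no
  root is multiple is expressed by the absence of a factor \<open>(X - a)\<^sup>2\<close>.
\<close>

lemma (in algebraically_closed) card_roots_of_separable:
  assumes P: "P \<in> carrier (poly_ring L)" and "P \<noteq> []"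
    and simple: "\<And>a g. a \<in> carrier L \<Longrightarrow> g \<in> carrier (poly_ring L) \<Longrightarrow>
      P \<noteq> [\<one>, \<ominus> a] \<otimes>\<^bsub>poly_ring L\<^esub> ([\<one>, \<ominus> a] \<otimes>\<^bsub>poly_ring L\<^esub> g)"
  shows "card {a \<in> carrier L. eval P a = \<zero>} = degree P"
proof -
  interpret UP: domain "poly_ring L"
    using univ_poly_is_domain[OF carrier_is_subring] .
  have roots: "set_mset (roots P) = {a \<in> carrier L. eval P a = \<zero>}"
    using roots_mem_iff_is_root[OF P] \<open>P \<noteq> []\<close> by (auto simp: is_root_def)
  have "count (roots P) a = 1" if a: "a \<in># roots P" for a
  proof -
    have aL: "a \<in> carrier L" using a roots by auto
    have lin: "[\<one>, \<ominus> a] \<in> carrier (poly_ring L)"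
      using aL unfolding univ_poly_carrier[symmetric] polynomial_def by auto
    have "\<not> 2 \<le> alg_mult P a"
    proof
      assume "2 \<le> alg_mult P a"
      from le_alg_mult_imp_pdivides[OF aL P this]
      obtain g where g: "g \<in> carrier (poly_ring L)"
        and "P = ([\<one>, \<ominus> a] [^]\<^bsub>poly_ring L\<^esub> (2 :: nat)) \<otimes>\<^bsub>poly_ring L\<^esub> g"
        by (auto simp: pdivides_def)
      then have "P = [\<one>, \<ominus> a] \<otimes>\<^bsub>poly_ring L\<^esub> ([\<one>, \<ominus> a] \<otimes>\<^bsub>poly_ring L\<^esub> g)"
        using lin g by (simp add: numeral_2_eq_2 UP.m_assoc)
      then show False using simple[OF aL g] by blast
    qed
    moreover have "count (roots P) a = alg_mult P a"
      using alg_mult_eq_count_roots[OF P] by simp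
    ultimately show ?thesis using a by (simp add: count_greater_zero_iff[symmetric] del: count_greater_zero_iff)
  qed
  then have "size (roots P) = card (set_mset (roots P))"
    by (simp add: size_multiset_overloaded_eq)
  then show ?thesis
    using roots roots_over_carrier[OF P] by (simp add: splitted_def)
qed

text \<open>
  The fixed points are the roots of \<open>P = X\<^sup>q - X\<close> with \<open>q = p\<^sup>n\<close>, so it suffices that \<open>P\<close> has no multiple
  root.  If \<open>a\<close> is a root, then \<open>a\<^sup>q = a\<close>, and applying the freshman's dream to
  \<open>X = D + a\<close> with \<open>D = X - a\<close> gives \<open>P = D\<^sup>q - D = D (D\<^bsup>q-1\<^esup> - 1)\<close>.  The cofactor of \<open>D\<close> takes the value
  \<open>-1\<close> at \<open>a\<close>, so \<open>D\<close> divides \<open>P\<close> only once.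
\<close>

lemma (in algebraically_closed) card_frobenius_fixed_points:
  assumes p: "prime p" and char: "[p] \<cdot> \<one> = \<zero>" and n: "n > 0"
  shows "card {a \<in> carrier L. a [^] (p ^ n) = a} = p ^ n"
proof -
  define q where "q = p ^ n"
  have q: "q \<ge> 2"
    using prime_ge_2_nat[OF p] n self_le_power[of p n] by (simp add: q_def)
  interpret UP: domain "poly_ring L"
    using univ_poly_is_domain[OF carrier_is_subring] .
  have X: "X \<in> carrier (poly_ring L)" by (rule var_closed(1)[OF carrier_is_subring])
  define P where "P = X [^]\<^bsub>poly_ring L\<^esub> q \<ominus>\<^bsub>poly_ring L\<^esub> X"
  have P: "P \<in> carrier (poly_ring L)" using X by (simp add: P_def)
  have eval_P: "eval P a = a [^] q \<ominus> a" if a: "a \<in> carrier L" for a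
  proof -
    interpret ev: ring_hom_ring "poly_ring L" L "\<lambda>p. eval p a"
      by (rule eval_ring_hom[OF carrier_is_subring a])
    show ?thesis
      using X a by (simp add: P_def UP.minus_eq minus_eq ev.hom_nat_pow eval_var)
  qed
  have "degree P = q"
  proof -
    have d: "degree (X [^]\<^bsub>poly_ring L\<^esub> q) = q" "degree (\<ominus>\<^bsub>poly_ring L\<^esub> X) = 1"
      using polynomial_pow_degree[OF X] univ_poly_a_inv_degree[OF carrier_is_subring X]
      by (simp_all add: var_def)
    have "degree (poly_add (X [^]\<^bsub>poly_ring L\<^esub> q) (\<ominus>\<^bsub>poly_ring L\<^esub> X)) = max q 1"
      using q X d by (subst poly_add_degree_eq[OF carrier_is_subring])
        (simp_all add: univ_poly_carrier)
    then show ?thesis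
      using q by (simp add: P_def UP.minus_eq univ_poly_add)
  qed
  have charP: "[p] \<cdot>\<^bsub>poly_ring L\<^esub> \<one>\<^bsub>poly_ring L\<^esub> = \<zero>\<^bsub>poly_ring L\<^esub>"
  proof -
    interpret C: ring_hom_ring L "poly_ring L" poly_of_const
      using canonical_embedding_ring_hom[OF carrier_is_subring] by simp
    have "poly_of_const ([k] \<cdot> \<one>) = [k] \<cdot>\<^bsub>poly_ring L\<^esub> \<one>\<^bsub>poly_ring L\<^esub>" for k :: nat
      by (induction k) simp_all
    then show ?thesis using char C.hom_zero by metis
  qed
  have "card {a \<in> carrier L. eval P a = \<zero>} = degree P"
  proof (rule card_roots_of_separable[OF P])
    show "P \<noteq> []" using \<open>degree P = q\<close> q by auto
  next
    fix a g
    assume a: "a \<in> carrier L" and g: "g \<in> carrier (poly_ring L)"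
    define D where "D = [\<one>, \<ominus> a]"
    define A where "A = poly_of_const a"
    have D: "D \<in> carrier (poly_ring L)"
      using a unfolding D_def univ_poly_carrier[symmetric] polynomial_def by auto
    interpret ev: ring_hom_ring "poly_ring L" L "\<lambda>p. eval p a"
      by (rule eval_ring_hom[OF carrier_is_subring a])
    have eval_D: "eval D a = \<zero>"
      using a by (simp add: D_def r_neg)
    show "P \<noteq> [\<one>, \<ominus> a] \<otimes>\<^bsub>poly_ring L\<^esub> ([\<one>, \<ominus> a] \<otimes>\<^bsub>poly_ring L\<^esub> g)"
    proof
      assume "P = [\<one>, \<ominus> a] \<otimes>\<^bsub>poly_ring L\<^esub> ([\<one>, \<ominus> a] \<otimes>\<^bsub>poly_ring L\<^esub> g)"
      then have P_eq: "P = D \<otimes>\<^bsub>poly_ring L\<^esub> (D \<otimes>\<^bsub>poly_ring L\<^esub> g)"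
        by (simp add: D_def)
      have "eval P a = \<zero>"
        using D g by (simp add: P_eq eval_D)
      then have aq: "a [^] q = a"
        using a eval_P by simp
      interpret C: ring_hom_ring L "poly_ring L" poly_of_const
        using canonical_embedding_ring_hom[OF carrier_is_subring] by simp
      have A: "A \<in> carrier (poly_ring L)" "A [^]\<^bsub>poly_ring L\<^esub> q = A"
        using a aq C.hom_nat_pow[of a q] by (simp_all add: A_def)
      have "X = D \<oplus>\<^bsub>poly_ring L\<^esub> A"
        using a by (auto simp: D_def A_def var_def poly_of_const_def univ_poly_add l_neg)
      \<comment> \<open>The freshman's dream for \<open>(D + A)\<^sup>q\<close>, where \<open>A\<^sup>q = A\<close>.\<close>
      then have "P = D [^]\<^bsub>poly_ring L\<^esub> q \<oplus>\<^bsub>poly_ring L\<^esub> A \<ominus>\<^bsub>poly_ring L\<^esub> (D \<oplus>\<^bsub>poly_ring L\<^esub> A)"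
        using UP.freshmans_dream[OF p charP D A(1), of n] A(2) by (simp add: P_def q_def)
      also have "\<dots> = D [^]\<^bsub>poly_ring L\<^esub> q \<ominus>\<^bsub>poly_ring L\<^esub> D"
        using D A(1) UP.nat_pow_closed[OF D, of q] by algebra
      also have "D [^]\<^bsub>poly_ring L\<^esub> q = D \<otimes>\<^bsub>poly_ring L\<^esub> D [^]\<^bsub>poly_ring L\<^esub> (q - 1)"
        using D q by (metis Suc_diff_1 UP.nat_pow_Suc2 not_numeral_le_zero not_gr_zero)
      also have "\<dots> \<ominus>\<^bsub>poly_ring L\<^esub> D
          = D \<otimes>\<^bsub>poly_ring L\<^esub> (D [^]\<^bsub>poly_ring L\<^esub> (q - 1) \<ominus>\<^bsub>poly_ring L\<^esub> \<one>\<^bsub>poly_ring L\<^esub>)"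
        using D by (simp add: UP.minus_eq UP.r_distr UP.r_minus)
      finally have "D [^]\<^bsub>poly_ring L\<^esub> (q - 1) \<ominus>\<^bsub>poly_ring L\<^esub> \<one>\<^bsub>poly_ring L\<^esub> = D \<otimes>\<^bsub>poly_ring L\<^esub> g"
        using P_eq D g UP.m_lcancel[of D] by (auto simp: D_def univ_poly_zero)
      \<comment> \<open>Both sides are evaluated at \<open>a\<close>, where \<open>D\<close> vanishes.\<close>
      from arg_cong[OF this, of "\<lambda>p. eval p a"]
      have "\<zero> [^] (q - 1) \<ominus> \<one> = \<zero>"
        using D g by (simp add: UP.minus_eq minus_eq ev.hom_nat_pow eval_D)
      then show False
        using q by (simp add: nat_pow_zero minus_eq)
    qed
  qed
  moreover have "{a \<in> carrier L. eval P a = \<zero>} = {a \<in> carrier L. a [^] (p ^ n) = a}"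
    using eval_P by (auto simp: q_def)
  ultimately show ?thesis using \<open>degree P = q\<close> by (simp add: q_def)
qed

text \<open>
  Closure under addition and negation is the freshman's dream; the other closure properties hold
  because taking powers is multiplicative.
\<close>

lemma (in field) subfield_frobenius_fixed_points:
  fixes p n :: nat
  assumes p: "prime p" and char: "[p] \<cdot> \<one> = \<zero>"
  shows "subfield {a \<in> carrier R. a [^] (p ^ n) = a} R"
proof (rule subfieldI')
  let ?K = "{a \<in> carrier R. a [^] (p ^ n) = a}"
  have neg: "(\<ominus> a) [^] (p ^ n) = \<ominus> a" if a: "a \<in> carrier R" "a [^] (p ^ n) = a" for a
  proof -
    have "(a \<oplus> \<ominus> a) [^] (p ^ n) = \<zero>"
      using a prime_gt_0_nat[OF p] by (simp add: r_neg nat_pow_zero)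
    then have "a \<oplus> (\<ominus> a) [^] (p ^ n) = \<zero>"
      using freshmans_dream[OF p char a(1), of "\<ominus> a" n] a by simp
    then show ?thesis using a minus_equality[of "(\<ominus> a) [^] (p ^ n)" a]
      by (simp add: a_comm)
  qed
  show "subring ?K R"
    by (rule subringI) (auto simp: neg nat_pow_distrib freshmans_dream[OF p char])
  show "inv k \<in> ?K" if "k \<in> ?K - {\<zero>}" for k
  proof -
    have k: "k \<in> carrier R" "k \<in> Units R" "k [^] (p ^ n) = k"
      using that by (auto simp: field_Units)
    then have "(inv k) [^] (p ^ n) \<otimes> k = inv k \<otimes> k"
      using nat_pow_distrib[of "inv k" k "p ^ n"] by simp
    then show ?thesis
      using k that m_rcancel[of k "(inv k) [^] (p ^ n)" "inv k"] by auto
  qed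
qed

text \<open>
  The field of \<open>p\<^sup>n\<close> elements is cut out of the algebraic closure of \<open>\<int>/p\<int>\<close> as the set of solutions of
  \<open>x\<^bsup>p\<^sup>n\<^esup> = x\<close>; being finite, it can then be renamed to have natural numbers as elements.
\<close>

lemma exists_finite_field:
  assumes "primepow q"
  shows "\<exists>F :: nat ring. field F \<and> card (carrier F) = q"
proof -
  obtain p n where p: "prime p" and n: "n > 0" and q: "q = p ^ n"
    using assms by (auto simp: primepow_def)
  interpret Z: residues_prime p "residue_ring (int p)"
    using p by unfold_locales simp_all
  interpret Z: field "residue_ring (int p)" by (rule Z.is_field)
  define L where "L = Z.alg_closure"
  interpret L: algebraic_closure L "Z.indexed_const ` carrier (residue_ring (int p))"
    unfolding L_def by (rule Z.alg_closureE(1))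
  interpret h: ring_hom_ring "residue_ring (int p)" L Z.indexed_const
    unfolding L_def
    by (intro ring_hom_ringI2 Z.alg_closureE(2)) (use Z.is_ring L.is_ring in \<open>simp_all add: L_def\<close>)
  have "Z.indexed_const ([k] \<cdot>\<^bsub>residue_ring (int p)\<^esub> \<one>\<^bsub>residue_ring (int p)\<^esub>) = [k] \<cdot>\<^bsub>L\<^esub> \<one>\<^bsub>L\<^esub>" for k :: nat
    by (induction k) simp_all
  moreover have "[k] \<cdot>\<^bsub>residue_ring (int p)\<^esub> \<one>\<^bsub>residue_ring (int p)\<^esub> = int k mod int p" for k :: nat
    by (induction k) (simp_all add: Z.res_zero_eq Z.res_one_eq Z.res_add_eq mod_add_right_eq add.commute)
  ultimately have char: "[p] \<cdot>\<^bsub>L\<^esub> \<one>\<^bsub>L\<^esub> = \<zero>\<^bsub>L\<^esub>"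
    using h.hom_zero by (metis Z.res_zero_eq mod_self)
  define K where "K = {a \<in> carrier L. a [^]\<^bsub>L\<^esub> (p ^ n) = a}"
  interpret K: field "L\<lparr>carrier := K\<rparr>"
    unfolding K_def
    using L.subfield_iff(2) L.subfield_frobenius_fixed_points[OF p char] by blast
  have cardK: "card K = q"
    unfolding K_def q by (rule L.card_frobenius_fixed_points[OF p char n])
  moreover have "q > 0"
    using q p prime_gt_0_nat by simp
  ultimately have "finite K" by (metis card.infinite less_irrefl)
  then obtain f :: "_ \<Rightarrow> nat" where f: "inj_on f K"
    using finite_imp_inj_to_nat_seg by blast
  then have "field (image_ring f (L\<lparr>carrier := K\<rparr>))"
    by (intro K.inj_imp_image_ring_is_field) simp
  moreover have "card (carrier (image_ring f (L\<lparr>carrier := K\<rparr>))) = q"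
    using card_image[OF f] cardK by (simp add: image_ring_carrier)
  ultimately show ?thesis by blast
qed

section \<open>The order of a finite domain\<close>

text \<open>
  If a prime \<open>l\<close> divides the order, a Sylow subgroup of the additive group contains some \<open>x \<noteq> 0\<close> that
  is killed by a power of \<open>l\<close>; since there are no zero divisors, that power kills \<open>1\<close> as well.
  For two different primes, two coprime numbers would kill \<open>1\<close>, which forces \<open>1 = 0\<close>.
\<close>

lemma (in domain) unique_prime_dvd_card:
  fixes p r :: nat
  assumes fin: "finite (carrier R)"
    and p: "prime p" "p dvd card (carrier R)" and r: "prime r" "r dvd card (carrier R)"
  shows "p = r"
proof (rule ccontr)
  assume "p \<noteq> r"
  let ?N = "card (carrier R)"
  have N: "?N > 0" using fin by (auto simp: card_gt_0_iff)
  have char: "\<exists>k. [(l ^ k)] \<cdot> \<one> = \<zero>" if l: "prime l" "l dvd ?N" for l :: nat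
  proof -
    define e where "e = multiplicity l ?N"
    have e: "e > 0" using l N by (simp add: e_def prime_multiplicity_gt_zero_iff)
    obtain m where m: "?N = l ^ e * m"
      using multiplicity_dvd[of l ?N] unfolding e_def by blast
    obtain H where H: "subgroup H (add_monoid R)" "card H = l ^ e"
      using sylow_thm[OF l(1) a_group, of e m] fin m by (auto simp: order_def)
    have "card H > 1" using H(2) e one_less_power[of l e] prime_gt_1_nat[OF l(1)] by simp
    then obtain x where x: "x \<in> H" "x \<noteq> \<zero>"
      by (metis card_le_Suc0_iff_eq card.infinite not_one_less_zero One_nat_def linorder_not_less)
    have xR: "x \<in> carrier R" using subgroup.mem_carrier[OF H(1) x(1)] by simp
    interpret H: group "(add_monoid R)\<lparr>carrier := H\<rparr>"
      using subgroup.subgroup_is_group[OF H(1) a_group] .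
    have "[(l ^ e)] \<cdot> x = \<zero>"
      using H.pow_order_eq_1[of x] x(1) H(2)
      by (simp add: order_def nat_pow_def add_pow_def)
    then have "([(l ^ e)] \<cdot> \<one>) \<otimes> x = \<zero>"
      using xR by (simp add: add_pow_ldistr)
    then have "[(l ^ e)] \<cdot> \<one> = \<zero>"
      using x(2) xR integral by blast
    then show ?thesis ..
  qed
  obtain i j where i: "[(p ^ i)] \<cdot> \<one> = \<zero>" and j: "[(r ^ j)] \<cdot> \<one> = \<zero>"
    using char p r by blast
  have "coprime (p ^ i) (r ^ j)"
    using p(1) r(1) \<open>p \<noteq> r\<close> by (simp add: primes_coprime)
  moreover have "add.ord \<one> dvd p ^ i" "add.ord \<one> dvd r ^ j"
    using i j add.pow_eq_id[of \<one>] by auto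
  ultimately have "add.ord \<one> = 1"
    using coprime_common_divisor_nat by blast
  then show False
    using add.pow_ord_eq_1[of \<one>] by simp
qed

lemma (in domain) primepow_card_carrier:
  assumes fin: "finite (carrier R)"
  shows "primepow (card (carrier R))"
proof -
  have "card (carrier R) > 1"
    by (metis fin One_nat_def card_le_Suc0_iff_eq linorder_not_less one_closed one_not_zero zero_closed)
  then obtain p where p: "prime p" "p dvd card (carrier R)"
    by (metis prime_factor_nat less_irrefl)
  have "prime_factors (card (carrier R)) = {p}"
    using p unique_prime_dvd_card[OF fin] \<open>card (carrier R) > 1\<close>
    by (auto simp: prime_factors_dvd)
  then have "card (carrier R) = p ^ multiplicity p (card (carrier R))"
    using prime_factorization_nat[of "card (carrier R)"] \<open>card (carrier R) > 1\<close> by simp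
  then show ?thesis
    using p \<open>card (carrier R) > 1\<close> by (metis less_irrefl power_0 primepow_prime_power not_gr_zero primepow_def)
qed

section \<open>Prime ideal graphs as complete split graphs\<close>

lemma consecutive_product_inj:
  fixes m n :: nat
  assumes "m * (m - 1) = n * (n - 1)" "m \<ge> 1" "n \<ge> 1"
  shows "m = n"
proof -
  have less: "i * (i - 1) < j * (j - 1)" if "i \<ge> 1" "i < j" for i j :: nat
    using that by (intro mult_le_less_imp_less) auto
  show ?thesis
    using less[of m n] less[of n m] assms by (cases m n rule: linorder_cases) auto
qed

text \<open>
  Since \<open>P\<close> is an ideal, its nonzero elements are adjacent to all other vertices; since it is prime,
  two elements outside \<open>P\<close> are never adjacent.  So the prime ideal graph is itself a complete split
  graph, and two such graphs with matching part sizes are isomorphic.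

  For the converse, the parts cannot be recovered from an isomorphism directly: for \<open>b = 1\<close> the graph
  is complete and the edgeless part is not determined.  Its size is determined, because the
  number \<open>b (b - 1)\<close> of ordered pairs of distinct non-adjacent vertices is an isomorphism invariant
  and is injective in \<open>b \<ge> 1\<close>.
\<close>

lemma realizes_complete_split_iff:
  fixes R :: "('r, 'm) ring_scheme"
  assumes "b \<ge> 1"
  shows "realizes R P (graph_join (complete_graph a) (edgeless_graph b)) \<longleftrightarrow>
    cring R \<and> finite (carrier R) \<and> primeideal P R \<and> card P = a + 1 \<and> card (carrier R - P) = b"
proof (cases "cring R \<and> finite (carrier R) \<and> primeideal P R")
  case False
  then show ?thesis by (auto simp: realizes_def)
next
  case True
  then have R: "cring R" and fin: "finite (carrier R)" and P: "primeideal P R" by simp_all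
  interpret primeideal P R by fact
  let ?S = "graph_join (complete_graph a) (edgeless_graph b)" and ?G = "prime_ideal_graph R P"
  have S: "pair_graph ?S"
    by (intro pair_graph_graph_join pair_graph_complete_graph pair_graph_edgeless_graph)
  have G: "pair_graph ?G"
    by (rule pair_graph_prime_ideal_graph[OF R fin])
  have finP: "finite P" using fin a_subset finite_subset by blast
  have zero: "\<zero>\<^bsub>R\<^esub> \<in> P" by simp
  have "P \<noteq> carrier R" using I_notcarr by simp
  then have compl: "card (carrier R - P) > 0"
    using fin a_subset by (auto simp: card_gt_0_iff)
  have G_verts: "pverts ?G = (P - {\<zero>\<^bsub>R\<^esub>}) \<union> (carrier R - P)"
    using a_subset zero by (auto simp: prime_ideal_graph_def)
  have G_arc: "(x, y) \<in> parcs ?G \<longleftrightarrow> x \<noteq> y \<and> (x \<in> P \<or> y \<in> P)"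
    if "x \<in> pverts ?G" "y \<in> pverts ?G" for x y
    using that I_prime I_l_closed I_r_closed by (auto simp: prime_ideal_graph_def)
  have S_verts: "pverts ?S = Inl ` {..<a} \<union> Inr ` {..<b}"
    by (simp add: graph_join_def complete_graph_def edgeless_graph_def)
  have S_arc: "(x, y) \<in> parcs ?S \<longleftrightarrow> x \<noteq> y \<and> (x \<in> range Inl \<or> y \<in> range Inl)"
    if "x \<in> pverts ?S" "y \<in> pverts ?S" for x y
    using that by (auto simp: graph_join_def complete_graph_def edgeless_graph_def)
  have "digraph_iso (with_proj ?S) (with_proj ?G) \<longleftrightarrow>
    card P = a + 1 \<and> card (carrier R - P) = b"
  proof
    assume "digraph_iso (with_proj ?S) (with_proj ?G)"
    then obtain f where bij: "bij_betw f (pverts ?S) (pverts ?G)"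
      and adj: "\<And>x y. x \<in> pverts ?S \<Longrightarrow> y \<in> pverts ?S \<Longrightarrow> (f x, f y) \<in> parcs ?G \<longleftrightarrow> (x, y) \<in> parcs ?S"
      unfolding digraph_iso_with_proj_iff[OF S G] by blast
    define B where "B = (Inr ` {..<b} :: (nat + nat) set)"
    define C where "C = carrier R - P"
    have inj: "inj_on f (pverts ?S)" and img: "f ` pverts ?S = pverts ?G"
      using bij by (simp_all add: bij_betw_def)
    have B: "{(x, y). x \<in> pverts ?S \<and> y \<in> pverts ?S \<and> x \<noteq> y \<and> (x, y) \<notin> parcs ?S} = B \<times> B - Id"
      using S_arc by (auto simp: S_verts B_def)
    have C: "{(x, y). x \<in> pverts ?G \<and> y \<in> pverts ?G \<and> x \<noteq> y \<and> (x, y) \<notin> parcs ?G} = C \<times> C - Id"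
      using G_arc by (auto simp: G_verts C_def)
    have "map_prod f f ` (B \<times> B - Id) = C \<times> C - Id"
      unfolding B[symmetric] C[symmetric] using adj inj unfolding img[symmetric]
      by (auto simp: inj_on_def image_iff)
    moreover have "inj_on (map_prod f f) (B \<times> B - Id)"
      by (rule inj_on_subset[OF map_prod_inj_on[OF inj inj]]) (auto simp: S_verts B_def)
    ultimately have eq: "card (B \<times> B - Id) = card (C \<times> C - Id)"
      by (metis card_image)
    have off_diag: "card (M \<times> M - Id) = card M * card M - card M" if "finite M" for M :: "'z set"
    proof -
      have "M \<times> M - Id = M \<times> M - (\<lambda>x. (x, x)) ` M" by auto
      then show ?thesis
        using that by (simp add: card_Diff_subset card_image inj_on_def image_subset_iff card_cartesian_product)
    qed
    show "card P = a + 1 \<and> card (carrier R - P) = b"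
    proof -
      have card_B: "card B = b" by (simp add: B_def card_image)
      have C': "card C > 0" "finite C" using compl fin by (simp_all add: C_def)
      have "b * b - b = card C * card C - card C"
        using eq off_diag[of B] off_diag[OF C'(2)] card_B by (simp add: B_def)
      then have "b * (b - 1) = card C * (card C - 1)"
        by (simp add: diff_mult_distrib2)
      then have "b = card C"
        by (rule consecutive_product_inj) (use assms C'(1) in auto)
      moreover have "card (pverts ?S) = a + b"
        unfolding S_verts by (subst card_Un_disjoint) (auto simp: card_image)
      moreover have "card (pverts ?G) = card P - 1 + card C"
        unfolding G_verts C_def using fin finP zero by (subst card_Un_disjoint) auto
      moreover have "card P > 0" using finP zero unfolding card_gt_0_iff by blast
      ultimately show ?thesis
        using bij_betw_same_card[OF bij] by (simp add: C_def)
    qed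
  next
    assume card: "card P = a + 1 \<and> card (carrier R - P) = b"
    then have "card (P - {\<zero>\<^bsub>R\<^esub>}) = card {..<a}" "card (carrier R - P) = card {..<b}"
      using finP zero by simp_all
    then obtain g h where g: "bij_betw g {..<a} (P - {\<zero>\<^bsub>R\<^esub>})" and h: "bij_betw h {..<b} (carrier R - P)"
      using finite_same_card_bij[of "{..<a}" "P - {\<zero>\<^bsub>R\<^esub>}"] finite_same_card_bij[of "{..<b}" "carrier R - P"]
        finP fin by auto
    define f where "f = case_sum g h"
    have "bij_betw f (Inl ` {..<a} \<union> Inr ` {..<b}) ((P - {\<zero>\<^bsub>R\<^esub>}) \<union> (carrier R - P))"
    proof (rule bij_betw_combine)
      show "bij_betw f (Inl ` {..<a}) (P - {\<zero>\<^bsub>R\<^esub>})" "bij_betw f (Inr ` {..<b}) (carrier R - P)"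
        using g h by (auto simp: f_def bij_betw_def inj_on_def image_image)
    qed auto
    then have bij: "bij_betw f (pverts ?S) (pverts ?G)"
      by (simp only: S_verts G_verts)
    moreover have "(f x, f y) \<in> parcs ?G \<longleftrightarrow> (x, y) \<in> parcs ?S"
      if x: "x \<in> pverts ?S" and y: "y \<in> pverts ?S" for x y
    proof -
      have "f z \<in> pverts ?G" if "z \<in> pverts ?S" for z
        using bij that by (auto simp: bij_betw_def)
      moreover have "f z \<in> P \<longleftrightarrow> z \<in> range Inl" if "z \<in> pverts ?S" for z
        using that g h by (auto simp: S_verts f_def bij_betw_def)
      moreover have "f x = f y \<longleftrightarrow> x = y"
        using bij x y by (auto simp: bij_betw_def inj_on_def)
      ultimately show ?thesis
        using x y by (simp add: G_arc S_arc)
    qed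
    ultimately show "digraph_iso (with_proj ?S) (with_proj ?G)"
      unfolding digraph_iso_with_proj_iff[OF S G] by blast
  qed
  then show ?thesis using True by (simp add: realizes_def)
qed

text \<open>
  The prime power is the order of the finite domain \<open>R / P\<close>: by Lagrange \<open>|R| = q |P|\<close>, and removing the
  coset \<open>P\<close> leaves \<open>(q - 1) |P|\<close> elements outside \<open>P\<close>.
\<close>

lemma realizes_complete_split_imp_primepow:
  fixes R :: "('r, 'm) ring_scheme"
  assumes b: "b \<ge> 1" and real: "realizes R P (graph_join (complete_graph a) (edgeless_graph b))"
  shows "\<exists>q :: nat. primepow q \<and> b = (a + 1) * (q - 1)"
proof -
  have R: "cring R" "finite (carrier R)" and P: "primeideal P R"
    and card_P: "card P = a + 1" and card_compl: "card (carrier R - P) = b"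
    using real unfolding realizes_complete_split_iff[OF b] by simp_all
  interpret primeideal P R by fact
  interpret Q: domain "R Quot P" by (rule quotient_is_domain)
  have lagrange: "card (carrier (R Quot P)) * card P = card (carrier R)"
    using a_lagrange[OF R(2) additive_subgroup_axioms] by (simp only: FactRing_def order_def partial_object.simps)
  have "card (carrier R) = a + 1 + b"
    using card_Diff_subset[OF finite_subset[OF a_subset R(2)] a_subset]
      card_mono[OF R(2) a_subset] card_P card_compl by simp
  with lagrange card_P have "b = (a + 1) * (card (carrier (R Quot P)) - 1)"
    by (simp add: diff_mult_distrib2 mult.commute)
  moreover have "card (carrier (R Quot P)) \<noteq> 0"
    using lagrange \<open>card (carrier R) = a + 1 + b\<close> by (intro notI) simp
  then have "finite (carrier (R Quot P))"
    by (intro card_ge_0_finite) simp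
  then have "primepow (card (carrier (R Quot P)))"
    by (rule Q.primepow_card_carrier)
  ultimately show ?thesis by blast
qed

section \<open>Realization by the product of a field and a cyclic ring\<close>

lemma card_carrier_ZFact:
  fixes n :: int
  assumes "n > 0"
  shows "card (carrier (ZFact n)) = nat n"
proof -
  have "carrier (ZFact n) = range (ZMod n)"
    by (auto simp: ZFact_defs A_RCOSETS_defs ZMod_def a_r_coset_def)
  also have "range (ZMod n) = ZMod n ` {0..<n}"
  proof -
    have "ZMod n r \<in> ZMod n ` {0..<n}" for r
      by (subst ZMod_mod, rule imageI) (use assms in simp)
    then show ?thesis by blast
  qed
  finally have "carrier (ZFact n) = ZMod n ` {0..<n}" .
  moreover have "inj_on (ZMod n) {0..<n}"
    by (auto intro!: inj_onI dest!: ZMod_imp_zmod)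
  ultimately show ?thesis by (simp add: card_image)
qed

lemma cring_RDirProd:
  assumes "cring R" "cring S"
  shows "cring (RDirProd R S)"
proof -
  interpret R: cring R by fact
  interpret S: cring S by fact
  interpret ring "RDirProd R S" by (rule RDirProd_ring[OF R.ring_axioms S.ring_axioms])
  show ?thesis
    by unfold_locales (auto simp: RDirProd_def DirProd_def monoid.defs R.m_comm S.m_comm)
qed

lemma primeideal_RDirProd_fst:
  assumes "domain F" "cring S"
  shows "primeideal ({\<zero>\<^bsub>F\<^esub>} \<times> carrier S) (RDirProd F S)"
proof -
  interpret F: domain F by fact
  interpret S: cring S by fact
  interpret D: cring "RDirProd F S"
    by (rule cring_RDirProd) unfold_locales
  interpret fst: ring_hom_ring "RDirProd F S" F fst
    by (rule ring_hom_ringI) (use D.ring_axioms F.ring_axioms in \<open>auto simp: RDirProd_def DirProd_def monoid.defs\<close>)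
  have "primeideal {r \<in> carrier (RDirProd F S). fst r \<in> {\<zero>\<^bsub>F\<^esub>}} (RDirProd F S)"
    by (rule fst.primeideal_vimage[OF D.cring_axioms F.zeroprimeideal])
  moreover have "{r \<in> carrier (RDirProd F S). fst r \<in> {\<zero>\<^bsub>F\<^esub>}} = {\<zero>\<^bsub>F\<^esub>} \<times> carrier S"
    by (auto simp: RDirProd_carrier)
  ultimately show ?thesis by simp
qed

text \<open>
  The complement of \<open>{0} \<times> \<int>/(a+1)\<int>\<close> consists of the pairs whose first component is one of the
  \<open>q - 1\<close> nonzero elements of the field, which makes \<open>(q - 1) (a + 1)\<close> pairs.
\<close>

lemma realizes_field_times_ZFact:
  assumes F: "field F" "card (carrier F) = q" and b: "b \<ge> 1" "b = (a + 1) * (q - 1)"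
  shows "realizes (RDirProd F (ZFact (int (a + 1))))
    ({\<zero>\<^bsub>F\<^esub>} \<times> carrier (ZFact (int (a + 1))))
    (graph_join (complete_graph a) (edgeless_graph b))"
proof -
  let ?Z = "ZFact (int (a + 1))"
  interpret F: field F by fact
  interpret Z: cring ?Z by (rule ZFact_is_cring)
  have card_Z: "card (carrier ?Z) = a + 1"
    using card_carrier_ZFact[of "int (a + 1)"] by simp
  have "q > 0" using b by (cases q) auto
  then have fin: "finite (carrier F)" "finite (carrier ?Z)"
    using F(2) card_Z by (metis card.infinite less_irrefl, metis card.infinite add_is_0 one_neq_zero)
  have "carrier F \<times> carrier ?Z - {\<zero>\<^bsub>F\<^esub>} \<times> carrier ?Z = (carrier F - {\<zero>\<^bsub>F\<^esub>}) \<times> carrier ?Z"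
    by auto
  then have "card (carrier F \<times> carrier ?Z - {\<zero>\<^bsub>F\<^esub>} \<times> carrier ?Z) = b"
    using fin F(2) card_Z b(2) by (simp add: card_cartesian_product mult.commute)
  moreover have "primeideal ({\<zero>\<^bsub>F\<^esub>} \<times> carrier ?Z) (RDirProd F ?Z)"
    by (rule primeideal_RDirProd_fst) unfold_locales
  moreover have "cring (RDirProd F ?Z)"
    by (rule cring_RDirProd) unfold_locales
  ultimately show ?thesis
    unfolding realizes_complete_split_iff[OF b(1)]
    using fin card_Z by (simp add: RDirProd_carrier card_cartesian_product)
qed

section \<open>Realization by rings of natural numbers and the characterization\<close>

text \<open>
  For a finite commutative ring with a prime ideal, realizing the graph is a matter of two
  cardinalities, so it carries over to an isomorphic copy of the ring; the prime ideal of the copy is obtained as a preimage under the inverse isomorphism.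
\<close>

lemma realizes_complete_split_nat_ring:
  fixes R :: "('r, 'm) ring_scheme"
  assumes b: "b \<ge> 1" and real: "realizes R P (graph_join (complete_graph a) (edgeless_graph b))"
  shows "\<exists>(R' :: nat ring) P'. realizes R' P' (graph_join (complete_graph a) (edgeless_graph b))"
proof -
  have R: "cring R" "finite (carrier R)" and P: "primeideal P R"
    and card: "card P = a + 1" "card (carrier R - P) = b"
    using real unfolding realizes_complete_split_iff[OF b] by simp_all
  interpret R: cring R by fact
  interpret primeideal P R by fact
  obtain f :: "'r \<Rightarrow> nat" where f: "inj_on f (carrier R)"
    using finite_imp_inj_to_nat_seg[OF R(2)] by blast
  let ?R = "image_ring f R"
  have iso: "f \<in> ring_iso R ?R" by (rule inj_imp_image_ring_iso[OF f])
  have cring: "cring ?R"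
    using R.ring_iso_imp_img_cring[OF iso] by (simp add: image_ring_def image_group_def monoid.defs)
  interpret R': cring ?R by (rule cring)
  let ?g = "inv_into (carrier R) f"
  interpret g: ring_hom_ring ?R R ?g
    by (intro ring_hom_ringI2 R'.ring_axioms R.ring_axioms)
       (use ring_iso_set_sym[OF R.ring_axioms iso] in \<open>simp add: ring_iso_def\<close>)
  have "primeideal {r \<in> carrier ?R. ?g r \<in> P} ?R"
    by (rule g.primeideal_vimage[OF cring P])
  moreover have "{r \<in> carrier ?R. ?g r \<in> P} = f ` P"
    using f a_subset by (auto simp: image_ring_carrier image_iff subset_iff)
  moreover have "card (f ` P) = card P"
    using f a_subset by (intro card_image) (rule inj_on_subset)
  moreover have "carrier ?R - f ` P = f ` (carrier R - P)"
    using inj_on_image_set_diff[OF f _ a_subset, of "carrier R"] by (simp add: image_ring_carrier)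
  then have "card (carrier ?R - f ` P) = card (carrier R - P)"
    using f by (simp add: card_image inj_on_diff)
  ultimately have "realizes ?R (f ` P) (graph_join (complete_graph a) (edgeless_graph b))"
    unfolding realizes_complete_split_iff[OF b]
    using R(2) card cring by (simp add: image_ring_carrier)
  then show ?thesis by blast
qed

theorem corollary2p5:
  fixes a b :: nat
  assumes "b \<ge> 1"
  shows "((\<exists>(R :: nat ring) P. realizes R P (graph_join (complete_graph a) (edgeless_graph b)))
          \<longleftrightarrow> (\<exists>q :: nat. primepow q \<and> b = (a + 1) * (q - 1)))
    \<and> (\<forall>(R :: 'r ring) P. realizes R P (graph_join (complete_graph a) (edgeless_graph b))
          \<longrightarrow> (\<exists>q :: nat. primepow q \<and> b = (a + 1) * (q - 1)))
    \<and> (\<forall>q :: nat. primepow q \<and> b = (a + 1) * (q - 1) \<longrightarrow>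
          (\<exists>F :: nat ring. field F \<and> card (carrier F) = q) \<and>
          (\<forall>F :: 'f ring. field F \<and> card (carrier F) = q \<longrightarrow>
            realizes (RDirProd F (ZFact (int (a + 1))))
              ({\<zero>\<^bsub>F\<^esub>} \<times> carrier (ZFact (int (a + 1))))
              (graph_join (complete_graph a) (edgeless_graph b))))"
proof (intro conjI iffI allI impI; (elim exE conjE)?)
  fix R :: "nat ring" and P
  assume "realizes R P (graph_join (complete_graph a) (edgeless_graph b))"
  then show "\<exists>q :: nat. primepow q \<and> b = (a + 1) * (q - 1)"
    by (rule realizes_complete_split_imp_primepow[OF assms])
next
  fix q :: nat
  assume q: "primepow q" "b = (a + 1) * (q - 1)"
  obtain F :: "nat ring" where "field F" "card (carrier F) = q"
    using exists_finite_field[OF q(1)] by blast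
  from realizes_field_times_ZFact[OF this assms q(2)]
  show "\<exists>(R :: nat ring) P. realizes R P (graph_join (complete_graph a) (edgeless_graph b))"
    by (rule realizes_complete_split_nat_ring[OF assms])
next
  fix R :: "'r ring" and P
  assume "realizes R P (graph_join (complete_graph a) (edgeless_graph b))"
  then show "\<exists>q :: nat. primepow q \<and> b = (a + 1) * (q - 1)"
    by (rule realizes_complete_split_imp_primepow[OF assms])
next
  fix q :: nat
  assume "primepow q"
  then show "\<exists>F :: nat ring. field F \<and> card (carrier F) = q"
    by (rule exists_finite_field)
next
  fix q :: nat and F :: "'f ring"
  assume "field F" "card (carrier F) = q" and q: "b = (a + 1) * (q - 1)"
  then show "realizes (RDirProd F (ZFact (int (a + 1))))
      ({\<zero>\<^bsub>F\<^esub>} \<times> carrier (ZFact (int (a + 1))))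
      (graph_join (complete_graph a) (edgeless_graph b))"
    by (intro realizes_field_times_ZFact[OF _ _ assms])
qed

end
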